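(* Let $n\ge 1$ and let $A$ and $B$ be origin-symmetric star bodies in $\mathbb{C}^n$, with $A$ circular with center $0$. If for every complex line $\ell$ through the origin in $\mathbb{C}^n$ we have $$\mathrm{area}(A\cap \ell)\ \le\ \mathrm{area}(B\cap\ell),$$ then $\mathrm{vol}(A)\le \mathrm{vol}(B)$.
   Context: Identify $\mathbb{C}^n$ with $\mathbb{R}^{2n}$ with its Euclidean structure and unit sphere $S^{2n-1}$. $\mathrm{vol}$ is $2n$-dimensional Lebesgue measure. A complex line through the origin is a $1$-dimensional complex vector subspace $\ell$ of $\mathbb{C}^n$; regarded as a real $2$-plane, $\mathrm{area}$ is the $2$-dimensional Lebesgue measure on $\ell$ induced by the Euclidean metric. A set $D\subset\mathbb{C}^n$ is star-shaped with respect to the origin if $0\in D$ and $tz\in D$ for all $z\in D$, $t\in[0,1]$. Its radial function is $\rho_D: S^{2n-1}\to[0,\infty)$, $\rho_D(\omega)=\max\{t\in[0,\infty) : t\omega\in D\}$. A star body is a set that is star-shaped with respect to the origin, whose radial function is well defined (the maximum exists and is finite for every $\omega$) and continuous. $D$ is origin-symmetric if $D=-D$. $D$ is circular with center $0$ if $e^{i\theta}z\in D$ for all $z\in D$ and all $\theta\in\mathbb{R}$. *)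

theory Defs
  imports "HOL-Analysis.Analysis"
begin

section \<open>Star bodies\<close>

definition star_shaped_origin :: "'a::real_vector set \<Rightarrow> bool" where
  "star_shaped_origin D \<longleftrightarrow> 0 \<in> D \<and> (\<forall>z\<in>D. \<forall>t\<in>{0..1}. t *\<^sub>R z \<in> D)"

definition is_radial_max :: "'a::real_vector set \<Rightarrow> 'a \<Rightarrow> real \<Rightarrow> bool" where
  "is_radial_max D \<omega> r \<longleftrightarrow> 0 \<le> r \<and> r *\<^sub>R \<omega> \<in> D \<and> (\<forall>t\<ge>0. t *\<^sub>R \<omega> \<in> D \<longrightarrow> t \<le> r)"

text \<open>Meaningful only where the maximum exists, which \<open>star_body\<close> requires on the unit sphere.\<close>

definition radial_function :: "'a::real_vector set \<Rightarrow> 'a \<Rightarrow> real" where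
  "radial_function D \<omega> = (THE r. is_radial_max D \<omega> r)"

definition star_body :: "'a::real_normed_vector set \<Rightarrow> bool" where
  "star_body D \<longleftrightarrow>
     star_shaped_origin D \<and>
     (\<forall>\<omega>\<in>sphere 0 1. \<exists>r. is_radial_max D \<omega> r) \<and>
     continuous_on (sphere 0 1) (radial_function D)"

definition origin_symmetric :: "'a::real_vector set \<Rightarrow> bool" where
  "origin_symmetric D \<longleftrightarrow> D = uminus ` D"

definition circular :: "(complex ^ 'n) set \<Rightarrow> bool" where
  "circular D \<longleftrightarrow> (\<forall>z\<in>D. \<forall>\<theta>::real. exp (\<i> * of_real \<theta>) *s z \<in> D)"

section \<open>Area on complex lines\<close>

text \<open>\<open>vec.subspace\<close> and \<open>vec.dim\<close> are taken over the scalar field of the vectors, here the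
  complex numbers (unlike \<open>subspace\<close> and \<open>dim\<close>, which are real).\<close>

definition complex_line :: "(complex ^ 'n) set \<Rightarrow> bool" where
  "complex_line l \<longleftrightarrow> vec.subspace l \<and> vec.dim l = 1"

text \<open>Lebesgue measure on a real two-dimensional subspace \<open>P\<close> is transported from the Euclidean
  plane, here \<^typ>\<open>complex\<close>, along a linear isometry onto \<open>P\<close>. The choice of isometry is
  immaterial by \<open>plane_area_eq\<close> below.\<close>

definition plane_isometry :: "'a::real_normed_vector set \<Rightarrow> (complex \<Rightarrow> 'a) \<Rightarrow> bool" where
  "plane_isometry P f \<longleftrightarrow> linear f \<and> (\<forall>w. norm (f w) = norm w) \<and> range f = P"

definition plane_area :: "'a::real_normed_vector set \<Rightarrow> 'a set \<Rightarrow> ennreal" where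
  "plane_area P S = emeasure lebesgue ((SOME f. plane_isometry P f) -` S)"

lemma norm_vector_scalar_mult: "norm (c *s x) = norm c * norm x" for x :: "complex ^ 'n"
  by (simp add: norm_vec_def norm_mult L2_set_right_distrib)

lemma plane_isometry_complex_line:
  fixes u :: "complex ^ 'n"
  assumes "norm u = 1"
  shows "plane_isometry (vec.span {u}) (\<lambda>w. w *s u)"
proof -
  have "linear (\<lambda>w. w *s u)"
    by (intro linearI)
      (auto simp: vec_eq_iff algebra_simps scaleR_conv_of_real[where 'a = complex])
  moreover have "norm (w *s u) = norm w" for w
    using assms by (simp add: norm_vector_scalar_mult)
  moreover have "range (\<lambda>w. w *s u) = vec.span {u}"
    by (auto simp: vec.span_singleton)
  ultimately show ?thesis
    by (simp add: plane_isometry_def)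
qed

lemma complex_line_plane_isometry:
  fixes l :: "(complex ^ 'n) set"
  assumes "complex_line l"
  obtains f where "plane_isometry l f"
proof -
  from assms have sub: "vec.subspace l" and dim: "vec.dim l = 1"
    by (auto simp: complex_line_def)
  obtain B where B: "B \<subseteq> l" "vec.independent B" "l \<subseteq> vec.span B" "card B = vec.dim l"
    using vec.basis_exists by blast
  then obtain v where v: "B = {v}"
    using dim by (metis card_1_singletonE)
  have v0: "v \<noteq> 0"
    using B(2) v vec.dependent_zero by auto
  define c where "c = complex_of_real (inverse (norm v))"
  have c0: "c \<noteq> 0"
    using v0 by (simp add: c_def)
  have "norm (c *s v) = 1"
    using v0 by (simp add: norm_vector_scalar_mult c_def norm_inverse)
  moreover have "vec.span {c *s v} = l"
  proof -
    have "vec.span {v} = l"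
      using B v sub by (simp add: vec.span_subspace)
    moreover have "vec.span {c *s v} = vec.span {v}"
      using vec.span_image_scale[of "{v}" "\<lambda>_. c"] c0 by simp
    ultimately show ?thesis by simp
  qed
  ultimately show ?thesis
    using plane_isometry_complex_line that by metis
qed

lemma distr_lborel_orthogonal_transformation:
  fixes g :: "real ^ 2 \<Rightarrow> real ^ 2"
  assumes g: "orthogonal_transformation g"
  shows "distr lborel borel g = lborel"
proof (rule lborel_eqI[symmetric])
  have lin: "linear g"
    using g by (rule orthogonal_transformation_linear)
  have meas [measurable]: "g \<in> borel_measurable borel"
    using lin by (simp add: linear_continuous_on linear_conv_bounded_linear borel_measurable_continuous_onI)
  fix l u :: "real ^ 2" assume le: "\<And>b. b \<in> Basis \<Longrightarrow> l \<bullet> b \<le> u \<bullet> b"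
  have bij: "bij g"
    using g by (rule orthogonal_transformation_bij)
  have img: "g -` box l u = inv g ` box l u"
    using bij by (simp add: bij_vimage_eq_inv_image)
  have inv: "orthogonal_transformation (inv g)"
    using g by (rule orthogonal_transformation_inv)
  have lm: "inv g ` box l u \<in> lmeasurable" "measure lebesgue (inv g ` box l u) = measure lebesgue (box l u)"
    by (rule measurable_orthogonal_image measure_orthogonal_image; simp add: inv)+
  have bm: "g -` box l u \<in> sets borel"
    using measurable_sets[OF meas, of "box l u"] by simp
  have "emeasure (distr lborel borel g) (box l u) = emeasure lebesgue (g -` box l u)"
    using bm by (simp add: emeasure_distr)
  also have "\<dots> = ennreal (measure lebesgue (box l u))"
    using lm by (simp add: img emeasure_eq_measure2)
  also have "\<dots> = (\<Prod>b\<in>Basis. (u - l) \<bullet> b)"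
    using le by (simp add: measure_lborel_box_eq)
  finally show "emeasure (distr lborel borel g) (box l u) = (\<Prod>b\<in>Basis. (u - l) \<bullet> b)" .
qed simp

lemma distr_lborel_isometry_complex:
  fixes k :: "complex \<Rightarrow> complex"
  assumes k: "linear k" "\<And>w. norm (k w) = norm w"
  shows "distr lborel borel k = lborel"
proof -
  define h where "h = (\<lambda>x :: real ^ 2. Complex (x $ 1) (x $ 2))"
  define h' where "h' = (\<lambda>w. vector [Re w, Im w] :: real ^ 2)"
  have hh' [simp]: "h (h' w) = w" for w
    by (simp add: h_def h'_def)
  have h'h [simp]: "h' (h x) = x" for x
    by (simp add: h_def h'_def vec_eq_iff forall_2)
  have lin_h: "linear h"
    by (intro linearI) (auto simp: h_def complex_eq_iff)
  have lin_h': "linear h'"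
    by (intro linearI) (auto simp: h'_def vec_eq_iff forall_2)
  have norm_h': "norm (h' w) = norm w" for w
    by (simp add: h'_def norm_vec_def L2_set_def sum_2 cmod_def)
  have norm_h: "norm (h x) = norm x" for x
    by (metis h'h norm_h')
  have [measurable]: "h \<in> borel_measurable borel" "h' \<in> borel_measurable borel"
      "k \<in> borel_measurable borel"
    using lin_h lin_h' k(1) by (auto intro!: borel_measurable_continuous_onI linear_continuous_on simp: linear_conv_bounded_linear)
  have distr_h: "distr lborel borel h = lborel"
  proof (rule lborel_eqI[symmetric])
    fix l u :: complex assume le: "\<And>b. b \<in> Basis \<Longrightarrow> l \<bullet> b \<le> u \<bullet> b"
    have "h -` box l u = box (h' l) (h' u)"
      by (auto simp: h_def h'_def mem_box_cart forall_2 in_box_complex_iff)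
    then have "emeasure (distr lborel borel h) (box l u) = emeasure lborel (box (h' l) (h' u))"
      by (simp add: emeasure_distr)
    also have "\<dots> = (\<Prod>b\<in>Basis. (h' u - h' l) \<bullet> b)"
    proof (rule emeasure_lborel_box)
      have "\<forall>i. h' l $ i \<le> h' u $ i"
        using le[of 1] le[of \<i>] by (simp add: h'_def forall_2)
      then show "h' l \<bullet> b \<le> h' u \<bullet> b" if "b \<in> Basis" for b
        using that by (auto simp: Basis_vec_def inner_axis)
    qed
    also have "(\<Prod>b\<in>Basis. (h' u - h' l) \<bullet> b) = (\<Prod>b\<in>Basis. (u - l) \<bullet> b)"
    proof -
      have basis: "(Basis :: (real ^ 2) set) = {axis 1 1, axis 2 1}"
        by (auto simp: Basis_vec_def UNIV_2)
      have ne: "axis 1 1 \<noteq> (axis 2 1 :: real ^ 2)"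
        by (simp add: axis_eq_axis)
      show ?thesis
        unfolding basis using ne by (simp add: Basis_complex_def inner_axis h'_def)
    qed
    finally show "emeasure (distr lborel borel h) (box l u) = (\<Prod>b\<in>Basis. (u - l) \<bullet> b)" .
  qed simp
  define g where "g = h' \<circ> k \<circ> h"
  have "orthogonal_transformation g"
    unfolding orthogonal_transformation g_def using lin_h lin_h' k norm_h norm_h'
    by (auto intro!: linear_compose)
  then have g: "distr lborel borel g = lborel"
    by (rule distr_lborel_orthogonal_transformation)
  have [measurable]: "g \<in> borel_measurable borel"
    unfolding g_def by (intro measurable_comp[of _ _ borel]) auto
  have "distr lborel borel k = distr (distr lborel borel h) borel k"
    by (simp add: distr_h)
  also have "\<dots> = distr lborel borel (k \<circ> h)"
    by (subst distr_distr) auto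
  also have "k \<circ> h = h \<circ> g"
    by (auto simp: g_def)
  also have "distr lborel borel (h \<circ> g) = distr (distr lborel borel g) borel h"
    by (subst distr_distr) auto
  also have "\<dots> = lborel"
    by (simp add: g distr_h)
  finally show ?thesis .
qed

lemma emeasure_lebesgue_isometry_complex:
  fixes k :: "complex \<Rightarrow> complex"
  assumes k: "linear k" "\<And>w. norm (k w) = norm w"
  shows "emeasure lebesgue (k -` S) = emeasure lebesgue S"
proof -
  have main: "j -` T \<in> sets lebesgue \<and> emeasure lebesgue (j -` T) = emeasure lebesgue T"
    if j: "linear j" "\<And>w. norm (j w) = norm w" and T: "T \<in> sets lebesgue"
    for j :: "complex \<Rightarrow> complex" and T
  proof -
    have m: "j \<in> borel_measurable borel"
      using j(1) by (simp add: linear_continuous_on linear_conv_bounded_linear borel_measurable_continuous_onI)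
    have d: "distr lebesgue lborel j = lborel"
      using distr_lborel_isometry_complex[OF j] m
      by (simp add: distr_completion cong: distr_cong)
    have jm: "j \<in> lebesgue \<rightarrow>\<^sub>M lebesgue"
      using m by (intro completion.measurable_completion2) (simp_all add: d measurable_completion)
    have "completion (distr lebesgue lborel j) = distr lebesgue lebesgue j"
      using m by (intro completion.completion_distr_eq) (simp_all add: d measurable_completion)
    then have "distr lebesgue lebesgue j = lebesgue"
      by (simp only: d)
    then show ?thesis
      using emeasure_distr[OF jm T] measurable_sets[OF jm T] by simp
  qed
  have inj: "inj k"
    using k by (metis linear_injective_0 norm_eq_zero)
  then have "surj k"
    using k(1) by (simp add: linear_injective_imp_surjective)
  with inj have bij: "bij k"
    by (simp add: bij_def)
  have k_inv: "k (inv k w) = w" for w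
    using \<open>surj k\<close> by (rule surj_f_inv_f)
  have inv: "linear (inv k)"
    using inj_linear_imp_inv_linear[OF k(1) inj] .
  have norm_inv: "norm (inv k w) = norm w" for w
    using k(2)[of "inv k w"] by (simp add: k_inv)
  have "inv k -` (k -` S) = S"
    by (auto simp: k_inv)
  then show ?thesis
    using main[OF k, of S] main[OF inv norm_inv, of "k -` S"] emeasure_notin_sets by metis
qed

lemma plane_area_eq:
  assumes f: "plane_isometry P f"
  shows "plane_area P S = emeasure lebesgue (f -` S)"
proof -
  define g where "g = (SOME f. plane_isometry P f)"
  have g: "plane_isometry P g"
    unfolding g_def using someI[of "plane_isometry P", OF f] .
  have inj: "inj g"
    using g unfolding plane_isometry_def by (metis linear_injective_0 norm_eq_zero)
  define k where "k = (\<lambda>w. inv g (f w))"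
  have gk: "g (k w) = f w" for w
    using f g unfolding k_def plane_isometry_def by (metis f_inv_into_f rangeI)
  have "linear k"
  proof (rule linearI)
    fix x y :: complex and c :: real
    have "g (k (x + y)) = g (k x + k y)"
      using f g by (simp add: gk plane_isometry_def linear_add)
    then show "k (x + y) = k x + k y"
      using inj by (rule injD[rotated])
    have "g (k (c *\<^sub>R x)) = g (c *\<^sub>R k x)"
      using f g by (simp add: gk plane_isometry_def linear_cmul)
    then show "k (c *\<^sub>R x) = c *\<^sub>R k x"
      using inj by (rule injD[rotated])
  qed
  moreover have "norm (k w) = norm w" for w
    using f g gk unfolding plane_isometry_def by metis
  moreover have "f -` S = k -` (g -` S)"
    by (auto simp: gk)
  ultimately show ?thesis
    by (simp add: plane_area_def g_def[symmetric] emeasure_lebesgue_isometry_complex)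
qed

end

theory Submission
  imports Defs
begin

text \<open>Extend the radial function to \<open>r D z = radial_function D (sgn z) / norm z\<close>, homogeneous of
  degree \<open>-1\<close>. In real dimension \<open>N\<close>, the volume of \<open>D\<close> is a fixed multiple of the integral of
  \<open>r D ^ N\<close> over the annulus \<open>1 \<le> norm y \<le> 2\<close>. For \<open>N = 2\<close> on a complex line through \<open>u\<close>, where
  \<open>r A\<close> is rotation invariant, the hypothesis says that \<open>r A u ^ 2\<close> is at most the mean of
  \<open>r B (c *s u) ^ 2\<close> over the unit circle of \<open>c\<close>. By the power mean inequality the same holds with
  exponent \<open>2 * n\<close> in place of \<open>2\<close>; integrating over \<open>u\<close> in the annulus of \<open>\<complex>\<^sup>n\<close>, which each
  rotation by \<open>c\<close> preserves together with Lebesgue measure, gives the claim.\<close>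

section \<open>Homogeneous extension of the radial function\<close>

definition radial_ext :: "'a::real_normed_vector set \<Rightarrow> 'a \<Rightarrow> real" where
  "radial_ext D z = radial_function D (sgn z) / norm z"

text \<open>Two maxima bound each other, so existence alone makes the definite description denote
  the maximum.\<close>

lemma is_radial_max_radial_function:
  assumes "\<exists>r. is_radial_max D \<omega> r"
  shows "is_radial_max D \<omega> (radial_function D \<omega>)"
proof -
  from assms obtain r where r: "is_radial_max D \<omega> r" by blast
  have "radial_function D \<omega> = r"
    unfolding radial_function_def
    using r by (intro the_equality) (auto simp: is_radial_max_def intro: antisym)
  with r show ?thesis by simp
qed

lemma radial_ext_nonneg:
  assumes "star_body D"
  shows "0 \<le> radial_ext D z"
proof (cases "z = 0")
  case False
  then have "is_radial_max D (sgn z) (radial_function D (sgn z))"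
    using assms by (intro is_radial_max_radial_function) (auto simp: star_body_def norm_sgn)
  then show ?thesis
    by (simp add: radial_ext_def is_radial_max_def)
qed (simp add: radial_ext_def)

text \<open>Maximality of the radial function gives one direction. For the other, star-shapedness
  fills the segment between the origin and the farthest point of the ray.\<close>

lemma scaleR_mem_star_body_iff:
  assumes D: "star_body D" and z: "z \<noteq> 0" and t: "0 \<le> t"
  shows "t *\<^sub>R z \<in> D \<longleftrightarrow> t \<le> radial_ext D z"
proof -
  define r where "r = radial_function D (sgn z)"
  have r: "is_radial_max D (sgn z) r"
    using D z unfolding r_def
    by (intro is_radial_max_radial_function) (auto simp: star_body_def norm_sgn)
  have eq: "t *\<^sub>R z = (t * norm z) *\<^sub>R sgn z"
    using z by (simp add: sgn_div_norm)
  have le: "t \<le> radial_ext D z \<longleftrightarrow> t * norm z \<le> r"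
    using z by (simp add: radial_ext_def r_def pos_le_divide_eq)
  show ?thesis
  proof
    assume "t *\<^sub>R z \<in> D"
    then have "(t * norm z) *\<^sub>R sgn z \<in> D"
      using eq by simp
    then show "t \<le> radial_ext D z"
      using r t by (simp add: is_radial_max_def le)
  next
    assume "t \<le> radial_ext D z"
    then have tr: "t * norm z \<le> r"
      by (simp add: le)
    show "t *\<^sub>R z \<in> D"
    \<comment> \<open>The radial function may vanish in some directions, and the shrinking factor
      below divides by \<open>r\<close>.\<close>
    proof (cases "r = 0")
      case True
      then have "t = 0"
        using tr t z by (simp add: mult_le_0_iff)
      then show ?thesis
        using D by (simp add: star_body_def star_shaped_origin_def)
    next
      case False
      have "r *\<^sub>R sgn z \<in> D" "0 < r"
        using r False by (auto simp: is_radial_max_def)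
      moreover have "t * norm z / r \<in> {0..1}"
        using t tr \<open>0 < r\<close> by simp
      ultimately have "(t * norm z / r) *\<^sub>R (r *\<^sub>R sgn z) \<in> D"
        using D unfolding star_body_def star_shaped_origin_def by blast
      then show ?thesis
        using \<open>0 < r\<close> by (simp add: eq)
    qed
  qed
qed

lemma mem_star_body_iff:
  assumes "star_body D" "z \<noteq> 0"
  shows "z \<in> D \<longleftrightarrow> 1 \<le> radial_ext D z"
  using scaleR_mem_star_body_iff[OF assms, of 1] by simp

lemma radial_ext_scaleR:
  "0 < c \<Longrightarrow> radial_ext D (c *\<^sub>R z) = radial_ext D z / c"
  by (simp add: radial_ext_def sgn_scaleR)

lemma borel_measurable_radial_ext:
  fixes D :: "'a::euclidean_space set"
  assumes "star_body D"
  shows "radial_ext D \<in> borel_measurable borel"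
proof -
  have "continuous_on (- {0}) (radial_ext D)"
    unfolding radial_ext_def
    using assms
    by (intro continuous_intros continuous_on_compose2[of "sphere 0 1" "radial_function D" _ sgn])
      (auto simp: star_body_def norm_sgn split: if_splits)
  then have "(\<lambda>z. indicator (- {0}) z *\<^sub>R radial_ext D z) \<in> borel_measurable borel"
    by (intro borel_measurable_continuous_on_indicator) auto
  \<comment> \<open>At the origin both sides are 0, because division by \<open>norm 0\<close> yields
    0.\<close>
  moreover have "(\<lambda>z. indicator (- {0}) z *\<^sub>R radial_ext D z) = radial_ext D"
    by (auto simp: radial_ext_def fun_eq_iff split: split_indicator)
  ultimately show ?thesis by simp
qed

text \<open>Measurability is not part of \<open>star_body\<close>; it comes from the radial
  function. The origin is added by hand because \<open>radial_ext D 0 = 0\<close> misses the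
  threshold 1.\<close>

lemma borel_star_body:
  fixes D :: "'a::euclidean_space set"
  assumes "star_body D"
  shows "D \<in> sets borel"
proof -
  note [measurable] = borel_measurable_radial_ext[OF assms]
  have "0 \<in> D"
    using assms by (simp add: star_body_def star_shaped_origin_def)
  then have "z \<in> D \<longleftrightarrow> z = 0 \<or> 1 \<le> radial_ext D z" for z
    using mem_star_body_iff[OF assms, of z] by (cases "z = 0") auto
  then have "D = {z. z = 0 \<or> 1 \<le> radial_ext D z}"
    by blast
  also have "\<dots> \<in> sets borel"
    by measurable
  finally show ?thesis .
qed

section \<open>Volume as an integral over an annulus\<close>

lemma nn_integral_lborel_scaleR:
  fixes f :: "'a::euclidean_space \<Rightarrow> ennreal"
  assumes [measurable]: "f \<in> borel_measurable borel" and t: "0 < t"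
  shows "(\<integral>\<^sup>+z. f z \<partial>lborel) = (\<integral>\<^sup>+y. ennreal (t ^ DIM('a)) * f (t *\<^sub>R y) \<partial>lborel)"
proof -
  have "(\<integral>\<^sup>+z. f z \<partial>lborel) =
      (\<integral>\<^sup>+z. f z \<partial>density (distr lborel borel (\<lambda>x. 0 + t *\<^sub>R x)) (\<lambda>_. ennreal (\<bar>t\<bar> ^ DIM('a))))"
    using t by (subst lborel_affine[of t 0]) auto
  also have "\<dots> = (\<integral>\<^sup>+y. ennreal (t ^ DIM('a)) * f (t *\<^sub>R y) \<partial>lborel)"
    using t by (simp add: nn_integral_density nn_integral_distr)
  finally show ?thesis .
qed

text \<open>A full-dimensional substitute for the unit sphere: invariant under linear isometries,
  away from the origin, and measured by Lebesgue measure instead of a surface measure.\<close>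

definition annulus :: "'a::real_normed_vector set" where
  "annulus = {y. 1 \<le> norm y \<and> norm y \<le> 2}"

lemma annulus_borel [measurable]: "(annulus :: 'a::euclidean_space set) \<in> sets borel"
  unfolding annulus_def by measurable

lemma zero_notin_annulus: "y \<in> annulus \<Longrightarrow> y \<noteq> 0"
  by (auto simp: annulus_def)

text \<open>The measure \<open>dt / t\<close> is scale invariant, hence a value independent of
  \<open>a\<close>. For \<open>a = norm z\<close> the interval consists of those \<open>t\<close>
  for which \<open>z / t\<close> lies in the annulus.\<close>

lemma nn_integral_inverse_half:
  assumes "0 < a"
  shows "(\<integral>\<^sup>+t. ennreal (inverse t) * indicator {a / 2..a} t \<partial>lborel) = ennreal (ln 2)"
proof -
  have "(\<integral>\<^sup>+t. ennreal (inverse t) * indicator {a / 2..a} t \<partial>lborel) = ennreal (ln a - ln (a / 2))"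
    using assms
    by (intro nn_integral_FTC_Icc) (auto intro!: DERIV_subset[OF DERIV_ln] derivative_eq_intros)
  also have "ln a - ln (a / 2) = ln 2"
    using assms by (simp add: ln_div)
  finally show ?thesis .
qed

lemma nn_integral_power_Ioc:
  assumes "0 \<le> a" "0 < k"
  shows "(\<integral>\<^sup>+t. ennreal (t ^ (k - 1)) * indicator {0<..a} t \<partial>lborel) = ennreal (a ^ k / k)"
proof -
  have "(\<integral>\<^sup>+t. ennreal (t ^ (k - 1)) * indicator {0<..a} t \<partial>lborel) =
      (\<integral>\<^sup>+t. ennreal (t ^ (k - 1)) * indicator {0..a} t \<partial>lborel)"
    by (intro nn_integral_cong_AE AE_I[of _ _ "{0}"]) (auto simp: indicator_def split: if_splits)
  also have "\<dots> = ennreal (a ^ k / k - 0 ^ k / k)"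
    using assms
    by (intro nn_integral_FTC_Icc) (auto intro!: derivative_eq_intros)
  finally show ?thesis using assms by (simp add: power_0_left)
qed

text \<open>Integrate \<open>1 / t\<close> over all \<open>t > 0\<close> and \<open>z \<in> D\<close> with \<open>z / t\<close> in the annulus, in both orders;
  this replaces integration in polar coordinates.\<close>

lemma emeasure_star_body:
  fixes D :: "'a::euclidean_space set"
  assumes D: "star_body D"
  shows "emeasure lborel D * ennreal (ln 2) =
    (\<integral>\<^sup>+y. ennreal (radial_ext D y ^ DIM('a) / DIM('a)) * indicator annulus y \<partial>lborel)"
proof -
  note [measurable] = borel_measurable_radial_ext[OF D] borel_star_body[OF D]
  define F :: "real \<Rightarrow> 'a \<Rightarrow> ennreal" where
    "F = (\<lambda>t z. ennreal (inverse t) * of_bool (0 < t \<and> z \<in> D \<and> t \<le> norm z \<and> norm z \<le> 2 * t))"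
  have [measurable]: "(\<lambda>(t, z). F t z) \<in> borel_measurable (borel \<Otimes>\<^sub>M borel)"
    unfolding F_def of_bool_def by measurable
  \<comment> \<open>This is \<open>F\<close> after substituting \<open>z = t *\<^sub>R y\<close>:
    the Jacobian \<open>t ^ DIM('a)\<close> absorbs the factor \<open>1 / t\<close>, and
    \<open>z \<in> D\<close> becomes \<open>t \<le> radial_ext D y\<close>.\<close>
  define G :: "real \<Rightarrow> 'a \<Rightarrow> ennreal" where
    "G = (\<lambda>t y. (ennreal (t ^ (DIM('a) - 1)) * indicator {0<..radial_ext D y} t) * indicator annulus y)"
  \<comment> \<open>The interval in \<open>G\<close> depends on \<open>y\<close>; a single
    \<open>of_bool\<close> condition exposes measurability jointly in \<open>t\<close> and
    \<open>y\<close>.\<close>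
  have G_alt: "G = (\<lambda>t y. ennreal (t ^ (DIM('a) - 1)) * of_bool (0 < t \<and> t \<le> radial_ext D y \<and> y \<in> annulus))"
    by (auto simp: G_def fun_eq_iff indicator_def)
  have [measurable]: "(\<lambda>(t, z). G t z) \<in> borel_measurable (borel \<Otimes>\<^sub>M borel)"
    unfolding G_alt of_bool_def by measurable
  have "emeasure lborel D * ennreal (ln 2) = (\<integral>\<^sup>+z. ennreal (ln 2) * indicator D z \<partial>lborel)"
    by (subst nn_integral_cmult_indicator) (auto simp: mult.commute)
  also have "\<dots> = (\<integral>\<^sup>+z. (\<integral>\<^sup>+t. F t z \<partial>lborel) \<partial>lborel)"
  \<comment> \<open>The identity fails at the origin, where the left side is \<open>ln 2\<close> and
    the right side 0.\<close>
  proof (intro nn_integral_cong_AE AE_I[of _ _ "{0}"])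
    have "ennreal (ln 2) * indicator D z = (\<integral>\<^sup>+t. F t z \<partial>lborel)" if "z \<noteq> 0" for z
    proof -
      have "(\<integral>\<^sup>+t. F t z \<partial>lborel) =
          (\<integral>\<^sup>+t. indicator D z * (ennreal (inverse t) * indicator {norm z / 2..norm z} t) \<partial>lborel)"
        using that zero_less_norm_iff[of z]
        by (intro nn_integral_cong) (auto simp: F_def indicator_def simp del: zero_less_norm_iff)
      also have "\<dots> = indicator D z * ennreal (ln 2)"
        using that by (simp add: nn_integral_cmult nn_integral_inverse_half)
      finally show ?thesis by (simp add: mult.commute)
    qed
    then show "{z \<in> space lborel. ennreal (ln 2) * indicator D z \<noteq> (\<integral>\<^sup>+t. F t z \<partial>lborel)} \<subseteq> {0}"
      by auto
  qed auto
  also have "\<dots> = (\<integral>\<^sup>+t. (\<integral>\<^sup>+z. F t z \<partial>lborel) \<partial>lborel)"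
    by (rule lborel_pair.Fubini') measurable
  also have "\<dots> = (\<integral>\<^sup>+t. (\<integral>\<^sup>+y. G t y \<partial>lborel) \<partial>lborel)"
  proof (rule nn_integral_cong)
    fix t :: real
    show "(\<integral>\<^sup>+z. F t z \<partial>lborel) = (\<integral>\<^sup>+y. G t y \<partial>lborel)"
    proof (cases "0 < t")
      case True
      have "ennreal (t ^ DIM('a)) * F t (t *\<^sub>R y) = G t y" for y
      proof -
        have "t *\<^sub>R y \<in> D \<longleftrightarrow> t \<le> radial_ext D y" if "y \<in> annulus"
          using that True by (simp add: scaleR_mem_star_body_iff[OF D] zero_notin_annulus)
        moreover have "t \<le> norm (t *\<^sub>R y) \<and> norm (t *\<^sub>R y) \<le> 2 * t \<longleftrightarrow> y \<in> annulus"
          using True by (simp add: annulus_def)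
        moreover have "ennreal (t ^ DIM('a)) * ennreal (inverse t) = ennreal (t ^ (DIM('a) - 1))"
          using True by (simp add: ennreal_mult[symmetric] power_diff field_simps)
        ultimately show ?thesis
          using True by (auto simp: F_def G_alt)
      qed
      then show ?thesis
        using True by (subst nn_integral_lborel_scaleR[of _ t]) auto
    qed (auto simp: F_def G_def)
  qed
  also have "\<dots> = (\<integral>\<^sup>+y. (\<integral>\<^sup>+t. G t y \<partial>lborel) \<partial>lborel)"
    by (rule lborel_pair.Fubini') measurable
  also have "\<dots> = (\<integral>\<^sup>+y. ennreal (radial_ext D y ^ DIM('a) / DIM('a)) * indicator annulus y \<partial>lborel)"
    unfolding G_def using radial_ext_nonneg[OF D]
    by (intro nn_integral_cong) (simp add: nn_integral_multc nn_integral_power_Ioc del: One_nat_def)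
  finally show ?thesis .
qed


section \<open>Invariance of Lebesgue measure under linear isometries\<close>

lemma nn_integral_lborel_translate:
  fixes f :: "'a::euclidean_space \<Rightarrow> ennreal"
  assumes [measurable]: "f \<in> borel_measurable borel"
  shows "(\<integral>\<^sup>+x. f (c + x) \<partial>lborel) = (\<integral>\<^sup>+x. f x \<partial>lborel)"
proof -
  have "(\<integral>\<^sup>+x. f x \<partial>lborel) = (\<integral>\<^sup>+x. f x \<partial>distr lborel borel ((+) c))"
    by (simp only: lborel_distr_plus)
  then show ?thesis
    by (simp add: nn_integral_distr)
qed

text \<open>The pushforward of \<open>lborel\<close> is translation invariant and agrees with \<open>lborel\<close> on the unit
  ball; the proof is the usual uniqueness argument for Haar measure.\<close>

lemma distr_lborel_isometry:
  fixes g :: "'a::euclidean_space \<Rightarrow> 'a"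
  assumes lin: "linear g" and norm: "\<And>x. norm (g x) = norm x"
  shows "distr lborel borel g = lborel"
proof (rule measure_eqI)
  have [measurable]: "g \<in> borel_measurable borel"
    using lin by (simp add: linear_continuous_on linear_conv_bounded_linear borel_measurable_continuous_onI)
  have "inj g"
    using lin norm by (metis linear_injective_0 norm_eq_zero)
  then have surj: "surj g"
    using lin by (simp add: linear_injective_imp_surjective)
  fix S assume "S \<in> sets (distr lborel borel g)"
  then have S [measurable]: "S \<in> sets borel" by simp
  define V where "V = emeasure lborel (cball (0::'a) 1)"
  have V: "emeasure lborel (cball x 1) = V" for x :: 'a
    by (simp add: V_def emeasure_cball)
  have "V \<noteq> 0" "V \<noteq> top"
    by (simp_all add: V_def emeasure_cball less_imp_neq[OF unit_ball_vol_pos, symmetric])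
  have [measurable]: "(\<lambda>x. indicator S (g x) :: ennreal) \<in> borel_measurable borel"
    by (intro measurable_compose[of g borel borel "indicator S"]) auto
  have "(\<integral>\<^sup>+x. indicator S x \<partial>distr lborel borel g) = (\<integral>\<^sup>+x. indicator S (g x) \<partial>lborel)"
    by (rule nn_integral_distr) auto
  then have distr: "emeasure (distr lborel borel g) S = (\<integral>\<^sup>+x. indicator S (g x) \<partial>lborel)"
    by simp
  have [measurable]: "(\<lambda>(x, y). indicator S (g x) * of_bool (norm (y - g x) \<le> 1) :: ennreal)
      \<in> borel_measurable (borel \<Otimes>\<^sub>M borel)"
    unfolding of_bool_def by measurable
  have [measurable]: "(\<lambda>(x, y). of_bool (norm x \<le> 1) * indicator S (y + g x) :: ennreal)
      \<in> borel_measurable (borel \<Otimes>\<^sub>M borel)"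
    unfolding of_bool_def by measurable
  have "emeasure (distr lborel borel g) S * V = (\<integral>\<^sup>+x. indicator S (g x) \<partial>lborel) * V"
    by (simp add: distr)
  also have "\<dots> = (\<integral>\<^sup>+x. indicator S (g x) * V \<partial>lborel)"
    by (simp add: nn_integral_multc)
  also have "\<dots> = (\<integral>\<^sup>+x. (\<integral>\<^sup>+y. indicator S (g x) * of_bool (norm (y - g x) \<le> 1) \<partial>lborel) \<partial>lborel)"
  proof (rule nn_integral_cong)
    fix x
    have "V = (\<integral>\<^sup>+y. indicator (cball (g x) 1) y \<partial>lborel)"
      by (simp add: V)
    also have "\<dots> = (\<integral>\<^sup>+y. of_bool (norm (y - g x) \<le> 1) \<partial>lborel)"
      by (intro nn_integral_cong) (simp add: indicator_def dist_norm norm_minus_commute)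
    finally show "indicator S (g x) * V = (\<integral>\<^sup>+y. indicator S (g x) * of_bool (norm (y - g x) \<le> 1) \<partial>lborel)"
      by (simp add: nn_integral_cmult of_bool_def)
  qed
  also have "\<dots> = (\<integral>\<^sup>+y. (\<integral>\<^sup>+x. indicator S (g x) * of_bool (norm (y - g x) \<le> 1) \<partial>lborel) \<partial>lborel)"
    by (rule lborel_pair.Fubini'[symmetric]) measurable
  also have "\<dots> = (\<integral>\<^sup>+y. (\<integral>\<^sup>+x. of_bool (norm x \<le> 1) * indicator S (y + g x) \<partial>lborel) \<partial>lborel)"
  proof (rule nn_integral_cong)
    fix y
    \<comment> \<open>Shifting \<open>x\<close> by a preimage \<open>c\<close> of \<open>y\<close>
      turns \<open>y - g x\<close> into \<open>- g x\<close>, whose norm is \<open>norm x\<close>;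
      this removes \<open>g\<close> from the ball condition.\<close>
    obtain c where c: "y = g c"
      using surj by blast
    have "(\<integral>\<^sup>+x. indicator S (g x) * of_bool (norm (y - g x) \<le> 1) \<partial>lborel) =
        (\<integral>\<^sup>+x. indicator S (g (c + x)) * of_bool (norm (y - g (c + x)) \<le> 1) \<partial>lborel)"
      by (intro nn_integral_lborel_translate[symmetric]) (unfold of_bool_def, measurable)
    also have "\<dots> = (\<integral>\<^sup>+x. of_bool (norm x \<le> 1) * indicator S (y + g x) \<partial>lborel)"
      by (simp add: linear_add[OF lin] c norm mult.commute)
    finally show "(\<integral>\<^sup>+x. indicator S (g x) * of_bool (norm (y - g x) \<le> 1) \<partial>lborel) = \<dots>" .
  qed
  also have "\<dots> = (\<integral>\<^sup>+x. (\<integral>\<^sup>+y. of_bool (norm x \<le> 1) * indicator S (y + g x) \<partial>lborel) \<partial>lborel)"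
    by (rule lborel_pair.Fubini') measurable
  also have "\<dots> = (\<integral>\<^sup>+x. indicator (cball 0 1) (x :: 'a) * emeasure lborel S \<partial>lborel)"
  proof (rule nn_integral_cong)
    fix x :: 'a
    have "(\<integral>\<^sup>+y. indicator S (y + g x) \<partial>lborel) = (\<integral>\<^sup>+y. indicator S (g x + y) \<partial>lborel)"
      by (simp add: add.commute)
    also have "\<dots> = emeasure lborel S"
      by (subst nn_integral_lborel_translate) auto
    finally show "(\<integral>\<^sup>+y. of_bool (norm x \<le> 1) * indicator S (y + g x) \<partial>lborel) =
        indicator (cball 0 1) x * emeasure lborel S"
      by (auto simp: indicator_def)
  qed
  also have "\<dots> = emeasure lborel S * V"
    by (subst nn_integral_multc) (auto intro!: borel_measurable_indicator simp: V_def mult.commute)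
  finally show "emeasure (distr lborel borel g) S = emeasure lborel S"
    using \<open>V \<noteq> 0\<close> \<open>V \<noteq> top\<close> by (metis ennreal_mult_cancel_left mult.commute)
qed simp

section \<open>The power mean inequality\<close>

text \<open>The convex function \<open>x ^ Suc n\<close> lies above its tangent at \<open>a\<close>;
  the terms are arranged without subtraction so that the bound transfers to
  \<open>ennreal\<close>.\<close>

lemma tangent_le_power:
  fixes a x :: real
  assumes "0 \<le> a" "0 \<le> x"
  shows "real (Suc n) * a ^ n * x \<le> x ^ Suc n + real n * a ^ Suc n"
proof (induction n)
  case (Suc n)
  have "x ^ Suc (Suc n) + real (Suc n) * a ^ Suc (Suc n) - real (Suc (Suc n)) * a ^ Suc n * x =
      x * (x ^ Suc n + real n * a ^ Suc n - real (Suc n) * a ^ n * x) + real (Suc n) * a ^ n * (x - a)\<^sup>2"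
    by (simp add: power2_eq_square algebra_simps)
  also have "\<dots> \<ge> 0"
    using Suc assms by (intro add_nonneg_nonneg mult_nonneg_nonneg) auto
  finally show ?case by simp
qed simp

text \<open>Jensen's inequality for the \<open>n\<close>-th power, by integrating the tangent bound
  at \<open>a\<close>. A lower bound \<open>a\<close> for the mean suffices because the tangent has
  nonnegative slope. Finite total mass allows the constant term of the tangent to be
  cancelled.\<close>

lemma power_mean_le_nn_integral:
  assumes [measurable]: "h \<in> borel_measurable M" and h: "\<And>x. 0 \<le> h x" and a: "0 \<le> a"
    and fin: "emeasure M (space M) < top" and n: "0 < n"
    and le: "ennreal a * emeasure M (space M) \<le> (\<integral>\<^sup>+x. ennreal (h x) \<partial>M)"
  shows "ennreal (a ^ n) * emeasure M (space M) \<le> (\<integral>\<^sup>+x. ennreal (h x ^ n) \<partial>M)"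
proof -
  obtain k where k: "n = Suc k"
    using n by (cases n) auto
  define e where "e = emeasure M (space M)"
  have "ennreal (real k * a ^ n) * e + ennreal (a ^ n) * e = ennreal (real n * a ^ k * a) * e"
    using a by (simp add: k flip: distrib_right ennreal_plus) (simp add: algebra_simps)
  also have "\<dots> = ennreal (real n * a ^ k) * (ennreal a * e)"
    using a by (simp add: ennreal_mult mult.assoc)
  also have "\<dots> \<le> ennreal (real n * a ^ k) * (\<integral>\<^sup>+x. ennreal (h x) \<partial>M)"
    using le unfolding e_def by (intro mult_left_mono) auto
  also have "\<dots> = (\<integral>\<^sup>+x. ennreal (real n * a ^ k * h x) \<partial>M)"
    using a h by (simp add: ennreal_mult nn_integral_cmult)
  also have "\<dots> \<le> (\<integral>\<^sup>+x. ennreal (real k * a ^ n) + ennreal (h x ^ n) \<partial>M)"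
    using a h tangent_le_power[OF a h, of k]
    by (intro nn_integral_mono) (simp add: k add.commute flip: ennreal_plus)
  also have "\<dots> = ennreal (real k * a ^ n) * e + (\<integral>\<^sup>+x. ennreal (h x ^ n) \<partial>M)"
    by (simp add: nn_integral_add e_def)
  finally have "ennreal (real k * a ^ n) * e + ennreal (a ^ n) * e \<le>
      ennreal (real k * a ^ n) * e + (\<integral>\<^sup>+x. ennreal (h x ^ n) \<partial>M)" .
  moreover have "ennreal (real k * a ^ n) * e \<noteq> top"
    using fin by (simp add: e_def ennreal_mult_eq_top_iff)
  ultimately show ?thesis
    by (simp add: e_def ennreal_add_left_cancel_le)
qed

section \<open>Slices by complex lines and averages over directions\<close>

lemma continuous_on_vector_scalar_mult:
  fixes f :: "'a::topological_space \<Rightarrow> complex" and g :: "'a \<Rightarrow> complex ^ 'n"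
  assumes "continuous_on S f" "continuous_on S g"
  shows "continuous_on S (\<lambda>x. f x *s g x)"
  unfolding vector_scalar_mult_def
  using assms by (intro continuous_on_vec_lambda continuous_intros)

text \<open>The map \<open>w \<mapsto> w *s u\<close> commutes with real scaling and sends the unit
  circle into the unit sphere, so the radial function pulls back along it.\<close>

lemma star_body_slice:
  fixes B :: "(complex ^ 'n) set"
  assumes B: "star_body B" and u: "norm u = 1"
  shows "star_body {w. w *s u \<in> B}"
    and "radial_ext {w. w *s u \<in> B} w = radial_ext B (w *s u)"
proof -
  have scale: "(t *\<^sub>R w) *s u = t *\<^sub>R (w *s u)" for t :: real and w
    by (simp add: vec_eq_iff)
  have rad: "is_radial_max {w. w *s u \<in> B} w = is_radial_max B (w *s u)" for w
    by (simp add: is_radial_max_def fun_eq_iff scale)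
  then have radf: "radial_function {w. w *s u \<in> B} w = radial_function B (w *s u)" for w
    by (simp add: radial_function_def)
  have cont: "continuous_on (sphere 0 1) (radial_function B)"
    using B by (simp add: star_body_def)
  have "continuous_on (sphere 0 1) (\<lambda>w. radial_function B (w *s u))"
    by (rule continuous_on_compose2[OF cont])
      (auto simp: norm_vector_scalar_mult u intro!: continuous_on_vector_scalar_mult continuous_intros)
  then show "star_body {w. w *s u \<in> B}"
    using B u unfolding star_body_def radf rad
    by (auto simp: star_shaped_origin_def scale norm_vector_scalar_mult)
  show "radial_ext {w. w *s u \<in> B} w = radial_ext B (w *s u)"
    using u by (simp add: radial_ext_def radf sgn_div_norm norm_vector_scalar_mult scale)
qed


lemma radial_ext_sgn:
  fixes y :: "complex ^ 'n"
  assumes "w \<noteq> 0"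
  shows "radial_ext B (sgn w *s y) = norm w * radial_ext B (w *s y)"
proof -
  have "sgn w *s y = inverse (norm w) *\<^sub>R (w *s y)"
    by (simp add: vec_eq_iff sgn_div_norm scaleR_conv_of_real[where 'a = complex])
  then show ?thesis
    using assms by (simp add: radial_ext_scaleR field_simps)
qed

text \<open>Multiplication by \<open>c\<close> and by \<open>inverse c\<close> both map
  \<open>A\<close> into itself, so the rays through \<open>y\<close> and \<open>c *s y\<close> meet
  \<open>A\<close> for the same \<open>t\<close>; these \<open>t\<close> determine
  \<open>radial_ext\<close>.\<close>

lemma radial_ext_circular:
  assumes A: "star_body A" "circular A" and c: "norm c = 1"
  shows "radial_ext A (c *s y) = radial_ext A y"
proof (cases "y = 0")
  case False
  have *: "b *s z \<in> A" if "norm b = 1" "z \<in> A" for b z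
    using A(2) that unfolding circular_def
    by (metis cis_conv_exp complex_norm_eq_1_exp)
  have "c \<noteq> 0"
    using c by auto
  have "t *\<^sub>R (c *s y) \<in> A \<longleftrightarrow> t *\<^sub>R y \<in> A" for t :: real
  proof -
    have "t *\<^sub>R (c *s y) = c *s (t *\<^sub>R y)" "t *\<^sub>R y = inverse c *s (t *\<^sub>R (c *s y))"
      using \<open>c \<noteq> 0\<close> by (auto simp: vec_eq_iff)
    then show ?thesis
      using *[OF c, of "t *\<^sub>R y"] *[of "inverse c" "t *\<^sub>R (c *s y)"] c
      by (metis inverse_1 norm_inverse)
  qed
  moreover have "c *s y \<noteq> 0"
    using False c by auto
  ultimately have "t \<le> radial_ext A (c *s y) \<longleftrightarrow> t \<le> radial_ext A y" if "0 \<le> t" for t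
    using scaleR_mem_star_body_iff[OF A(1)] that False by metis
  then show ?thesis
    using radial_ext_nonneg[OF A(1)] by (metis order.eq_iff)
qed simp

text \<open>On a punctured complex line, the function \<open>w \<mapsto> norm w ^ 2 * radial_ext B (w *s u) ^ 2\<close>
  depends only on the direction of \<open>w\<close>, so integrating against this weight averages over
  directions.\<close>

definition angular_measure :: "complex measure" where
  "angular_measure = density lborel (\<lambda>w. ennreal (inverse ((norm w)\<^sup>2)) * indicator annulus w)"

lemma sets_angular_measure [simp, measurable_cong]: "sets angular_measure = sets borel"
  by (simp add: angular_measure_def)

lemma space_angular_measure [simp]: "space angular_measure = UNIV"
  by (simp add: angular_measure_def)

lemma nn_integral_angular_measure:
  assumes "f \<in> borel_measurable borel"
  shows "(\<integral>\<^sup>+w. f w \<partial>angular_measure) =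
    (\<integral>\<^sup>+w. ennreal (inverse ((norm w)\<^sup>2)) * f w * indicator annulus w \<partial>lborel)"
  unfolding angular_measure_def
  using assms by (subst nn_integral_density) (auto intro!: nn_integral_cong simp: mult_ac)

text \<open>The density vanishes off the annulus. This discards \<open>w = 0\<close>, the only point
  where \<open>sgn w\<close> is not a rotation.\<close>

lemma AE_angular_measure_nonzero: "AE w in angular_measure. w \<noteq> 0"
  unfolding angular_measure_def
  by (subst AE_density) (auto simp: annulus_def indicator_def)

lemma angular_measure_finite: "emeasure angular_measure UNIV < top"
proof -
  have "emeasure angular_measure UNIV = (\<integral>\<^sup>+w. 1 \<partial>angular_measure)"
    by simp
  also have "\<dots> = (\<integral>\<^sup>+w. ennreal (inverse ((norm w)\<^sup>2)) * 1 * indicator annulus (w :: complex) \<partial>lborel)"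
    by (rule nn_integral_angular_measure[of "\<lambda>_. 1"]) simp
  also have "\<dots> \<le> (\<integral>\<^sup>+w. indicator (cball 0 2) (w::complex) \<partial>lborel)"
    by (intro nn_integral_mono)
      (auto simp: annulus_def indicator_def ennreal_le_1 inverse_le_1_iff)
  also have "\<dots> < top"
    by (simp add: emeasure_cball)
  finally show ?thesis .
qed

lemma angular_measure_nonzero: "emeasure angular_measure UNIV \<noteq> 0"
proof -
  \<comment> \<open>The ball of radius \<open>1 / 2\<close> about \<open>3 / 2\<close> lies in the
    annulus, where \<open>norm w \<le> 2\<close> makes the density at least
    \<open>1 / 4\<close>.\<close>
  have "0 < (\<integral>\<^sup>+w. ennreal (1 / 4) * indicator (ball (3 / 2) (1 / 2)) (w::complex) \<partial>lborel)"
    by (simp add: nn_integral_cmult_indicator emeasure_ball flip: ennreal_mult)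
  also have "\<dots> \<le> (\<integral>\<^sup>+w. ennreal (inverse ((norm w)\<^sup>2)) * 1 * indicator annulus (w :: complex) \<partial>lborel)"
  proof (rule nn_integral_mono)
    fix w :: complex
    show "ennreal (1 / 4) * indicator (ball (3 / 2) (1 / 2)) w \<le>
        ennreal (inverse ((norm w)\<^sup>2)) * 1 * indicator annulus w"
    proof (cases "w \<in> ball (3 / 2) (1 / 2)")
      case True
      have "norm (3 / 2 :: complex) = 3 / 2"
        by simp
      then have w: "1 \<le> norm w" "norm w \<le> 2"
        using True norm_triangle_ineq2[of "3 / 2" w] norm_triangle_ineq2[of w "3 / 2"]
        by (auto simp: dist_norm norm_minus_commute)
      then have "(norm w)\<^sup>2 \<le> 2\<^sup>2"
        by (intro power_mono) auto
      moreover have "0 < (norm w)\<^sup>2"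
        using w by (intro zero_less_power) linarith
      ultimately have "1 / 4 \<le> inverse ((norm w)\<^sup>2)"
        using le_imp_inverse_le[of "(norm w)\<^sup>2" 4] by simp
      then show ?thesis
        using w True by (simp add: annulus_def)
    qed simp
  qed
  also have "\<dots> = emeasure angular_measure UNIV"
    using nn_integral_angular_measure[of "\<lambda>_. 1"] by simp
  finally show ?thesis by simp
qed

lemma borel_measurable_vector_scalar_mult [measurable]:
  fixes f :: "'a \<Rightarrow> complex" and g :: "'a \<Rightarrow> complex ^ 'n"
  assumes [measurable]: "f \<in> borel_measurable M" "g \<in> borel_measurable M"
  shows "(\<lambda>x. f x *s g x) \<in> borel_measurable M"
proof -
  have "(\<lambda>p. fst p *s snd p :: complex ^ 'n) \<in> borel_measurable borel"
    by (intro borel_measurable_continuous_onI continuous_on_vector_scalar_mult continuous_intros)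
  then have "(\<lambda>x. fst (f x, g x) *s snd (f x, g x)) \<in> borel_measurable M"
    by (rule measurable_compose[rotated]) measurable
  then show ?thesis by simp
qed

text \<open>This is the annulus formula in real dimension 2 for the slice in the coordinate
  \<open>w\<close>. By homogeneity its integrand splits into a function of \<open>sgn w\<close> and
  the density of \<open>angular_measure\<close>.\<close>

lemma plane_area_slice:
  fixes B :: "(complex ^ 'n) set"
  assumes B: "star_body B" and u: "norm u = 1"
  shows "plane_area (vec.span {u}) (B \<inter> vec.span {u}) * ennreal (ln 2) =
    (\<integral>\<^sup>+w. ennreal (radial_ext B (sgn w *s u) ^ 2 / 2) \<partial>angular_measure)"
proof -
  note [measurable] = borel_measurable_radial_ext[OF B]
  define E where "E = {w. w *s u \<in> B}"
  have E: "star_body E" and ext: "radial_ext E w = radial_ext B (w *s u)" for w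
    unfolding E_def using star_body_slice[OF B u] by auto
  have "(\<lambda>w. w *s u) -` (B \<inter> vec.span {u}) = E"
    by (auto simp: E_def vec.span_singleton)
  then have "plane_area (vec.span {u}) (B \<inter> vec.span {u}) = emeasure lborel E"
    using plane_area_eq[OF plane_isometry_complex_line[OF u]] borel_star_body[OF E] by simp
  then have "plane_area (vec.span {u}) (B \<inter> vec.span {u}) * ennreal (ln 2) =
      (\<integral>\<^sup>+w. ennreal (radial_ext B (w *s u) ^ 2 / 2) * indicator annulus w \<partial>lborel)"
    using emeasure_star_body[OF E] by (simp add: ext)
  also have "\<dots> = (\<integral>\<^sup>+w. ennreal (inverse ((norm w)\<^sup>2)) * ennreal (radial_ext B (sgn w *s u) ^ 2 / 2) *
      indicator annulus w \<partial>lborel)"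
    by (intro nn_integral_cong)
      (auto simp: indicator_def zero_notin_annulus radial_ext_sgn power_mult_distrib simp flip: ennreal_mult)
  also have "\<dots> = (\<integral>\<^sup>+w. ennreal (radial_ext B (sgn w *s u) ^ 2 / 2) \<partial>angular_measure)"
    by (rule nn_integral_angular_measure[symmetric]) measurable
  finally show ?thesis .
qed

section \<open>Comparison of volumes by averaging over rotations\<close>

theorem theorem2:
  fixes A B :: "(complex ^ 'n) set"
  assumes "star_body A" and "origin_symmetric A" and "circular A"
    and "star_body B" and "origin_symmetric B"
    and "\<And>l. complex_line l \<Longrightarrow> plane_area l (A \<inter> l) \<le> plane_area l (B \<inter> l)"
  shows "emeasure lebesgue A \<le> emeasure lebesgue B"
proof -
  note A = \<open>star_body A\<close> and B = \<open>star_body B\<close>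
  note [measurable] = borel_measurable_radial_ext[OF A] borel_measurable_radial_ext[OF B]
  define e where "e = emeasure angular_measure UNIV"
  define n where "n = CARD('n)"
  have dim: "DIM(complex ^ 'n) = 2 * n" and n: "0 < n"
    by (simp_all add: n_def)
  define f where "f = (\<lambda>D (y :: complex ^ 'n). ennreal (radial_ext D y ^ (2 * n) / (2 * real n)) * indicator annulus y)"
  have [measurable]: "f A \<in> borel_measurable borel" "f B \<in> borel_measurable borel"
    unfolding f_def by measurable
  \<comment> \<open>Star bodies are Borel, so \<open>lebesgue\<close> and \<open>lborel\<close>
    agree on them.\<close>
  have vol: "emeasure lebesgue D * ennreal (ln 2) = (\<integral>\<^sup>+y. f D y \<partial>lborel)" if "star_body D" for D
    using emeasure_star_body[OF that] borel_star_body[OF that] by (simp only: dim f_def) simp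
  interpret finite_measure angular_measure
    using angular_measure_finite by (intro finite_measureI) auto
  interpret pair_sigma_finite angular_measure "lborel :: (complex ^ 'n) measure" ..
  \<comment> \<open>The area hypothesis compares averages of squares; the power mean inequality with
    exponent \<open>n\<close> lifts them to the power \<open>2 * n\<close> that occurs in the
    volume.\<close>
  have sphere: "ennreal ((radial_ext A u ^ 2 / 2) ^ n) * e \<le>
      (\<integral>\<^sup>+w. ennreal ((radial_ext B (sgn w *s u) ^ 2 / 2) ^ n) \<partial>angular_measure)"
    if u: "norm u = 1" for u
  proof -
    have "vec.dim (vec.span {u}) = 1"
    proof -
      have "vec.independent {u}"
        using u by (auto simp: vec.dependent_single)
      then show ?thesis
        by (simp add: vec.dim_span_eq_card_independent)
    qed
    then have line: "complex_line (vec.span {u})"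
      by (simp add: complex_line_def)
    have "ennreal (radial_ext A u ^ 2 / 2) * e =
        (\<integral>\<^sup>+w. ennreal (radial_ext A u ^ 2 / 2) \<partial>angular_measure)"
      by (simp add: e_def)
    \<comment> \<open>Circularity makes the integrand for \<open>A\<close> constant in
      \<open>w\<close>, so the slice area recovers the value at \<open>u\<close> itself.\<close>
    also have "\<dots> = (\<integral>\<^sup>+w. ennreal (radial_ext A (sgn w *s u) ^ 2 / 2) \<partial>angular_measure)"
      using AE_angular_measure_nonzero
      by (intro nn_integral_cong_AE, eventually_elim)
        (simp add: radial_ext_circular[OF A \<open>circular A\<close>] norm_sgn)
    also have "\<dots> = plane_area (vec.span {u}) (A \<inter> vec.span {u}) * ennreal (ln 2)"
      by (rule plane_area_slice[OF A u, symmetric])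
    also have "\<dots> \<le> plane_area (vec.span {u}) (B \<inter> vec.span {u}) * ennreal (ln 2)"
      using assms(6)[OF line] by (intro mult_right_mono) auto
    also have "\<dots> = (\<integral>\<^sup>+w. ennreal (radial_ext B (sgn w *s u) ^ 2 / 2) \<partial>angular_measure)"
      by (rule plane_area_slice[OF B u])
    finally show ?thesis
      unfolding e_def space_angular_measure[symmetric]
      by (intro power_mean_le_nn_integral angular_measure_finite[folded space_angular_measure] n) auto
  qed
  \<comment> \<open>Homogeneity carries the bound from the unit sphere to the annulus, which each
    \<open>sgn w\<close> with \<open>w \<noteq> 0\<close> preserves; elsewhere
    \<open>f A y = 0\<close>.\<close>
  have pointwise: "f A y * e \<le> (\<integral>\<^sup>+w. f B (sgn w *s y) \<partial>angular_measure)" for y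
  proof (cases "y \<in> annulus")
    case True
    then have y: "0 < norm y"
      using zero_notin_annulus by auto
    define u where "u = sgn y"
    have u: "norm u = 1"
      using y by (simp add: u_def norm_sgn)
    have yu: "y = norm y *\<^sub>R u"
      using y by (simp add: u_def sgn_div_norm)
    \<comment> \<open>The factor \<open>2 ^ n\<close> undoes the halving inside the
      \<open>n\<close>-th power, \<open>norm y ^ (2 * n)\<close> comes from homogeneity, and
      \<open>2 * real n\<close> is the normalization in \<open>f\<close>.\<close>
    define c where "c = 2 ^ n / (norm y ^ (2 * n) * (2 * real n))"
    have c: "0 \<le> c"
      by (simp add: c_def)
    have scale: "radial_ext D (b *s y) ^ (2 * n) / (2 * real n) = c * (radial_ext D (b *s u) ^ 2 / 2) ^ n" for D b
    proof -
      have "b *s y = norm y *\<^sub>R (b *s u)"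
        by (subst yu) (simp add: vec_eq_iff)
      then have "radial_ext D (b *s y) = radial_ext D (b *s u) / norm y"
        using y by (simp add: radial_ext_scaleR)
      then show ?thesis
        by (simp add: c_def power_divide power_mult)
    qed
    have "f A y * e = ennreal c * (ennreal ((radial_ext A u ^ 2 / 2) ^ n) * e)"
      using True scale[of A 1] c by (simp add: f_def ennreal_mult mult.assoc)
    also have "\<dots> \<le> ennreal c * (\<integral>\<^sup>+w. ennreal ((radial_ext B (sgn w *s u) ^ 2 / 2) ^ n) \<partial>angular_measure)"
      using sphere[OF u] by (rule mult_left_mono) simp
    also have "\<dots> = (\<integral>\<^sup>+w. ennreal (c * (radial_ext B (sgn w *s u) ^ 2 / 2) ^ n) \<partial>angular_measure)"
      using c by (simp add: nn_integral_cmult ennreal_mult)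
    also have "\<dots> = (\<integral>\<^sup>+w. f B (sgn w *s y) \<partial>angular_measure)"
      using AE_angular_measure_nonzero True
      by (intro nn_integral_cong_AE, elim eventually_mono)
        (simp add: f_def scale annulus_def norm_vector_scalar_mult norm_sgn)
    finally show ?thesis .
  qed (simp add: f_def)
  have "(emeasure lebesgue A * ennreal (ln 2)) * e = (\<integral>\<^sup>+y. f A y * e \<partial>lborel)"
    by (simp add: vol[OF A] nn_integral_multc)
  also have "\<dots> \<le> (\<integral>\<^sup>+y. (\<integral>\<^sup>+w. f B (sgn w *s y) \<partial>angular_measure) \<partial>lborel)"
    by (intro nn_integral_mono pointwise)
  also have "\<dots> = (\<integral>\<^sup>+w. (\<integral>\<^sup>+y. f B (sgn w *s y) \<partial>lborel) \<partial>angular_measure)"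
    by (rule Fubini') measurable
  \<comment> \<open>For fixed \<open>w \<noteq> 0\<close> the rotation by \<open>sgn w\<close>
    preserves Lebesgue measure, so the inner integral does not depend on \<open>w\<close> and
    averaging contributes only the total mass \<open>e\<close>.\<close>
  also have "\<dots> = (\<integral>\<^sup>+w. (\<integral>\<^sup>+y. f B y \<partial>lborel) \<partial>angular_measure)"
    using AE_angular_measure_nonzero
  proof (intro nn_integral_cong_AE, eventually_elim)
    fix w :: complex assume "w \<noteq> 0"
    have "distr lborel borel (\<lambda>y :: complex ^ 'n. sgn w *s y) = lborel"
      using \<open>w \<noteq> 0\<close>
      by (intro distr_lborel_isometry linearI)
        (auto simp: vec_eq_iff algebra_simps norm_vector_scalar_mult norm_sgn)
    then have "(\<integral>\<^sup>+y. f B y \<partial>lborel) =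
        (\<integral>\<^sup>+y. f B y \<partial>distr lborel borel (\<lambda>y :: complex ^ 'n. sgn w *s y))"
      by simp
    then show "(\<integral>\<^sup>+y. f B (sgn w *s y) \<partial>lborel) = (\<integral>\<^sup>+y. f B y \<partial>lborel)"
      by (simp add: nn_integral_distr)
  qed
  also have "\<dots> = (emeasure lebesgue B * ennreal (ln 2)) * e"
    by (simp add: vol[OF B] e_def)
  finally have "(ennreal (ln 2) * e) * emeasure lebesgue A \<le> (ennreal (ln 2) * e) * emeasure lebesgue B"
    by (simp add: mult_ac)
  \<comment> \<open>Both \<open>ln 2\<close> and the total mass are positive and finite, so the
    common factor cancels in \<open>ennreal\<close>.\<close>
  moreover have "ennreal (ln 2) * e \<noteq> 0" "ennreal (ln 2) * e \<noteq> top"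
    using angular_measure_nonzero angular_measure_finite
    by (auto simp: e_def ennreal_mult_eq_top_iff)
  ultimately show ?thesis
    by (simp add: ennreal_mult_le_mult_iff)
qed

end
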